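(* Let $H$ be a finite bipartite graph with parts $A$ and $B$ and edge set $E(H)\subseteq A\times B$, and let $\nu:V(H)\to\mathbb{R}_+$ be a vertex weight function. Let $\tilde{H}$ be the weighted graph with vertex set $E(H)$, in which $((a_1,b_1),(a_2,b_2))\in E(\tilde{H})$ if and only if $(a_1,b_2)\in E(H)$ and $(a_2,b_1)\in E(H)$ (in particular every vertex has a loop), and with vertex weights $\tilde{\nu}(a,b)=\nu(a)\nu(b)$ for $(a,b)\in E(H)$. Then for every $d\geq 1$ and every $d$-regular simple graph $G$ on $n$ vertices, $$Z(G,\tilde{H})\leq Z(K_{d+1},\tilde{H})^{n/(d+1)}.$$
   Context: For a graph $G$ and a (possibly looped) graph $F$ with vertex weight function $\mu:V(F)\to\mathbb{R}_+$, the partition function is $$Z(G,F)=\sum_{\varphi:V(G)\to V(F)}\ \prod_{(u,v)\in E(G)}\mathbb{I}_{E(F)}(\varphi(u),\varphi(v))\prod_{w\in V(G)}\mu(\varphi(w)),$$ where $\mathbb{I}_{E(F)}$ is the indicator function of the edge set of $F$; i.e. the sum over homomorphisms $G\to F$ of the product of the weights of the images of the vertices. $K_{d+1}$ is the complete graph on $d+1$ vertices. *)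

theory Defs
  imports
    Complex_Main
    "HOL-Library.FuncSet"
    "HOL-Library.Indicator_Function"
    "Graph_Theory.Kuratowski"
begin

text \<open>
  An undirected graph is a symmetric digraph, as in the \<^locale>\<open>pair_graph\<close> (simple) and
  \<^locale>\<open>pair_pseudo_graph\<close> (loops allowed) locales: an edge between distinct vertices is
  a pair of opposite arcs.
\<close>

definition regular_graph :: "nat \<Rightarrow> 'v pair_pre_digraph \<Rightarrow> bool" where
  "regular_graph d G \<longleftrightarrow> (\<forall>v\<in>pverts G. out_degree (with_proj G) v = d)"

definition complete_graph :: "nat \<Rightarrow> nat pair_pre_digraph" where
  "complete_graph n = \<lparr>pverts = {..<n}, parcs = {(u, v). u < n \<and> v < n \<and> u \<noteq> v}\<rparr>"

text \<open>
  The edge product ranges over arcs, so each edge of \<open>G\<close> contributes once per orientation.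
  For symmetric \<open>F\<close> both factors agree, and as they are 0 or 1 the repetition has no effect.
\<close>

definition partition_function ::
    "'v pair_pre_digraph \<Rightarrow> 'f pair_pre_digraph \<Rightarrow> ('f \<Rightarrow> real) \<Rightarrow> real" where
  "partition_function G F \<mu> =
     (\<Sum>\<phi> \<in> pverts G \<rightarrow>\<^sub>E pverts F.
        (\<Prod>(u, v)\<in>parcs G. indicator (parcs F) (\<phi> u, \<phi> v)) * (\<Prod>w\<in>pverts G. \<mu> (\<phi> w)))"

text \<open>
  \<open>E\<close> is the edge set of a bipartite graph, each edge oriented from the first part to the second.
\<close>

definition tilde_graph :: "('a \<times> 'a) set \<Rightarrow> ('a \<times> 'a) pair_pre_digraph" where
  "tilde_graph E =
     \<lparr>pverts = E,
      parcs = {((a1, b1), (a2, b2)) | a1 b1 a2 b2.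
                 (a1, b1) \<in> E \<and> (a2, b2) \<in> E \<and> (a1, b2) \<in> E \<and> (a2, b1) \<in> E}\<rparr>"

definition tilde_weight :: "('a \<Rightarrow> real) \<Rightarrow> 'a \<times> 'a \<Rightarrow> real" where
  "tilde_weight \<nu> = (\<lambda>(a, b). \<nu> a * \<nu> b)"

lemma complete_digraph_complete_graph: "complete_digraph n (with_proj (complete_graph n))"
  by (auto simp: complete_digraph_pair_def complete_graph_def)

lemma pair_pseudo_graph_tilde_graph:
  assumes "finite E"
  shows "pair_pseudo_graph (tilde_graph E)"
proof
  show "finite (parcs (tilde_graph E))"
    by (rule finite_subset[of _ "E \<times> E"]) (auto simp: tilde_graph_def assms)
qed (auto simp: tilde_graph_def assms symmetric_def sym_def)

lemma tilde_graph_loop: "e \<in> E \<Longrightarrow> (e, e) \<in> parcs (tilde_graph E)"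
  by (cases e) (auto simp: tilde_graph_def)

end

theory Submission
  imports Defs
begin

text \<open>
  A homomorphism from \<open>G\<close> to the tilde graph is a pair of maps \<open>(x, y)\<close> into the two parts of the
  bipartite graph such that \<open>(x u, y v)\<close> is an edge whenever \<open>u\<close> lies in the closed
  neighbourhood \<open>N[v]\<close>. Summing out \<open>y\<close> turns the partition function into a weighted sum over \<open>x\<close>
  of a product over \<open>v\<close> of functions of \<open>x\<close> restricted to \<open>N[v]\<close>. Every vertex lies in exactly
  \<open>d + 1\<close> closed neighbourhoods, so Finner's inequality bounds this by a product of \<open>L\<^sup>d\<^sup>+\<^sup>1\<close> norms.
  In the complete graph on \<open>d + 1\<close> vertices all closed neighbourhoods coincide, hence the
  \<open>(d + 1)\<close>-th power of each norm is the partition function of that graph.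
\<close>

section \<open>Arithmetic-geometric mean and Hoelder inequalities\<close>

text \<open>AM-GM for the numbers \<open>t i ^ k\<close>: scaled by their mean \<open>m\<close>,
  each is bounded through \<open>z \<le> exp (z - 1)\<close>, and the exponents add up to 0. If
  \<open>m = 0\<close>, scaling fails, but then every \<open>t i\<close> vanishes.\<close>

lemma prod_le_mean_power:
  fixes t :: "'i \<Rightarrow> real"
  assumes "finite I" "card I = k" "k > 0" "\<And>i. i \<in> I \<Longrightarrow> t i \<ge> 0"
  shows "(\<Prod>i\<in>I. t i) \<le> (\<Sum>i\<in>I. t i ^ k) / real k"
proof -
  define m where "m = (\<Sum>i\<in>I. t i ^ k) / real k"
  have m0: "m \<ge> 0"
    unfolding m_def using assms by (intro divide_nonneg_nonneg sum_nonneg) auto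
  show ?thesis
  proof (cases "m = 0")
    case True
    then have "(\<Sum>i\<in>I. t i ^ k) = 0" using assms by (simp add: m_def)
    then have "\<And>i. i \<in> I \<Longrightarrow> t i = 0"
      using assms by (subst (asm) sum_nonneg_eq_0_iff) auto
    moreover obtain i where "i \<in> I" using assms by fastforce
    ultimately have "(\<Prod>i\<in>I. t i) = 0" using assms(1) by (meson prod_zero)
    then show ?thesis using m0 by (simp add: m_def)
  next
    case False
    with m0 have mp: "m > 0" by simp
    have "(\<Prod>i\<in>I. t i ^ k / m) \<le> (\<Prod>i\<in>I. exp (t i ^ k / m - 1))"
      using assms mp exp_ge_add_one_self[of "t i ^ k / m - 1" for i]
      by (intro prod_mono) (auto simp: divide_nonneg_pos)
    also have "\<dots> = exp (\<Sum>i\<in>I. t i ^ k / m - 1)" by (simp add: exp_sum assms)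
    also have "(\<Sum>i\<in>I. t i ^ k / m - 1) = 0"
    proof -
      have "(\<Sum>i\<in>I. t i ^ k) = real k * m" using assms(3) by (simp add: m_def)
      then show ?thesis using assms(2) mp by (simp add: sum_subtractf flip: sum_divide_distrib)
    qed
    finally have "(\<Prod>i\<in>I. t i) ^ k \<le> m ^ k"
      using mp assms(2) by (simp add: prod_dividef prod_power_distrib divide_simps)
    then show ?thesis
      using m0 assms(3) unfolding m_def by (meson power_mono_iff prod_nonneg assms(4))
  qed
qed

text \<open>Hoelder's inequality for \<open>k\<close> functions, all with exponent \<open>k\<close>:
  scale each \<open>g i\<close> to weighted norm 1, apply AM-GM at every point \<open>a\<close>, and
  sum.\<close>

lemma sum_prod_le_prod_root:
  fixes w :: "'b \<Rightarrow> real" and g :: "'i \<Rightarrow> 'b \<Rightarrow> real"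
  assumes "finite A" "finite I" "card I = k" "k > 0"
    and w: "\<And>a. a \<in> A \<Longrightarrow> w a \<ge> 0"
    and g: "\<And>i a. i \<in> I \<Longrightarrow> a \<in> A \<Longrightarrow> g i a \<ge> 0"
  shows "(\<Sum>a\<in>A. w a * (\<Prod>i\<in>I. g i a)) \<le> (\<Prod>i\<in>I. root k (\<Sum>a\<in>A. w a * g i a ^ k))"
proof -
  define S where "S i = (\<Sum>a\<in>A. w a * g i a ^ k)" for i
  have S0: "S i \<ge> 0" if "i \<in> I" for i
    unfolding S_def using that w g by (intro sum_nonneg) auto
  show ?thesis
  proof (cases "\<exists>i\<in>I. S i = 0")
    \<comment> \<open>A vanishing norm cannot be divided out. It forces \<open>w a = 0\<close> or
      \<open>g i a = 0\<close> at each \<open>a\<close>, so the left side is 0.\<close>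
    case True
    then obtain i where i: "i \<in> I" "S i = 0" by blast
    have z: "w a = 0 \<or> g i a = 0" if "a \<in> A" for a
      using i(2) that w g i(1) assms(1) unfolding S_def
      by (subst (asm) sum_nonneg_eq_0_iff) auto
    have "w a * (\<Prod>i\<in>I. g i a) = 0" if "a \<in> A" for a
      using z[OF that] i(1) assms(2) by (auto intro: prod_zero)
    then have "(\<Sum>a\<in>A. w a * (\<Prod>i\<in>I. g i a)) = 0" by (intro sum.neutral ballI)
    also have "0 \<le> (\<Prod>i\<in>I. root k (S i))"
      using S0 by (intro prod_nonneg ballI real_root_ge_zero)
    finally show ?thesis unfolding S_def .
  next
    case False
    then have Sp: "S i > 0" if "i \<in> I" for i using S0[OF that] that by force
    define s where "s i = root k (S i)" for i
    have sp: "s i > 0" if "i \<in> I" for i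
      using Sp[OF that] assms(4) by (simp add: s_def)
    have sk: "s i ^ k = S i" if "i \<in> I" for i
      using Sp[OF that] assms(4) by (simp add: s_def)
    have Pp: "(\<Prod>i\<in>I. s i) > 0" using sp by (intro prod_pos) auto
    have "(\<Sum>a\<in>A. w a * (\<Prod>i\<in>I. g i a)) / (\<Prod>i\<in>I. s i)
        = (\<Sum>a\<in>A. w a * (\<Prod>i\<in>I. g i a / s i))"
      by (simp add: sum_divide_distrib prod_dividef)
    also have "\<dots> \<le> (\<Sum>a\<in>A. w a * ((\<Sum>i\<in>I. (g i a / s i) ^ k) / real k))"
      using sp w g assms
      by (intro sum_mono mult_left_mono prod_le_mean_power) (auto simp: divide_nonneg_pos)
    also have "\<dots> = (\<Sum>a\<in>A. \<Sum>i\<in>I. w a * g i a ^ k / S i / real k)"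
      by (intro sum.cong refl)
        (simp add: sum_divide_distrib sum_distrib_left power_divide sk)
    \<comment> \<open>After exchanging the sums, each \<open>i\<close> contributes the
      \<open>k\<close>-th power of a norm scaled to 1, divided by \<open>k\<close>.\<close>
    also have "\<dots> = (\<Sum>i\<in>I. (\<Sum>a\<in>A. w a * g i a ^ k) / S i / real k)"
      by (subst sum.swap) (simp add: sum_divide_distrib)
    also have "\<dots> = (\<Sum>i\<in>I. 1 / real k)"
    proof (rule sum.cong[OF refl])
      fix i assume "i \<in> I"
      then show "(\<Sum>a\<in>A. w a * g i a ^ k) / S i / real k = 1 / real k"
        using Sp[of i] by (simp flip: S_def)
    qed
    also have "\<dots> = 1" using assms by simp
    finally show ?thesis using Pp by (simp add: s_def S_def)
  qed
qed

section \<open>Finner's inequality\<close>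

lemma sum_PiE_insert:
  fixes h :: "('u \<Rightarrow> 'b) \<Rightarrow> real"
  assumes "finite S" "finite A" "u \<notin> S"
  shows "(\<Sum>x\<in>insert u S \<rightarrow>\<^sub>E A. h x) = (\<Sum>a\<in>A. \<Sum>x\<in>S \<rightarrow>\<^sub>E A. h (x(u := a)))"
proof -
  have "(\<Sum>x\<in>insert u S \<rightarrow>\<^sub>E A. h x) = (\<Sum>(a, x)\<in>A \<times> (S \<rightarrow>\<^sub>E A). h (x(u := a)))"
    unfolding PiE_insert_eq
    using inj_combinator[OF assms(3), of "\<lambda>_. A"]
    by (subst sum.reindex) (simp_all add: case_prod_unfold)
  then show ?thesis by (simp add: sum.cartesian_product)
qed

text \<open>Induction on \<open>S\<close>, one coordinate at a time. The sets \<open>N i\<close>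
  stay fixed while \<open>S\<close> shrinks, so the norms run over \<open>S \<inter> N i\<close>;
  \<open>F\<close> is generalised because the induction hypothesis is applied to slices of
  it.\<close>

lemma Finner_inequality:
  fixes w :: "'b \<Rightarrow> real" and F :: "'i \<Rightarrow> ('u \<Rightarrow> 'b) \<Rightarrow> real" and N :: "'i \<Rightarrow> 'u set"
  assumes "finite S" "finite I" "finite A" "k > 0"
    and w: "\<And>a. a \<in> A \<Longrightarrow> w a \<ge> 0"
    and F: "\<And>i x. i \<in> I \<Longrightarrow> F i x \<ge> 0"
    and card: "\<And>u. u \<in> S \<Longrightarrow> card {i\<in>I. u \<in> N i} = k"
  shows "(\<Sum>x\<in>S \<rightarrow>\<^sub>E A. (\<Prod>u\<in>S. w (x u)) * (\<Prod>i\<in>I. F i (restrict x (N i))))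
    \<le> (\<Prod>i\<in>I. root k (\<Sum>x\<in>S \<inter> N i \<rightarrow>\<^sub>E A. (\<Prod>u\<in>S \<inter> N i. w (x u)) * F i x ^ k))"
  using assms(1) F card
proof (induction S arbitrary: F rule: finite_induct)
  case empty
  have "root k (F i x ^ k) = F i x" if "i \<in> I" for i x
    using empty that assms(4) by (simp add: real_root_power_cancel)
  then show ?case by (simp add: restrict_def)
next
  case (insert u S)
  \<comment> \<open>The slice of \<open>F i\<close> at value \<open>a\<close> of coordinate
    \<open>u\<close>. If \<open>u\<close> is outside \<open>N i\<close>, no update may happen, since
    restricting to \<open>N i\<close> discards the value at \<open>u\<close>.\<close>
  define F' where "F' a i x = F i (if u \<in> N i then x(u := a) else x)" for a i x
  define P where "P T x = (\<Prod>v\<in>T. w (x v))" for T and x :: "'u \<Rightarrow> 'b"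
  \<comment> \<open>\<open>R i\<close> is the \<open>k\<close>-th power of the norm of
    \<open>F i\<close> with \<open>u\<close> among the coordinates; \<open>G i a\<close> is that of
    the slice at \<open>a\<close>, over the remaining coordinates.\<close>
  define R where "R i = (\<Sum>x\<in>insert u S \<inter> N i \<rightarrow>\<^sub>E A. P (insert u S \<inter> N i) x * F i x ^ k)" for i
  define G where "G i a = (\<Sum>x\<in>S \<inter> N i \<rightarrow>\<^sub>E A. P (S \<inter> N i) x * F' a i x ^ k)" for i a
  define J where "J = {i\<in>I. u \<in> N i}"
  have J: "finite J" "card J = k" "J \<subseteq> I"
    using insert.prems assms(2) by (auto simp: J_def)
  have P0: "P T x \<ge> 0" if "x \<in> T \<rightarrow>\<^sub>E A" for T x
    unfolding P_def using that w by (intro prod_nonneg) auto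
  have P_upd: "P T (x(u := a)) = P T x" if "u \<notin> T" for T x a
    unfolding P_def using that by (intro prod.cong) auto
  have P_ins: "P (insert u T) (x(u := a)) = w a * P T x" if "finite T" "u \<notin> T" for T x a
    using that P_upd[OF that(2)] by (simp add: P_def)
  have G0: "G i a \<ge> 0" if "i \<in> I" for i a
    unfolding G_def F'_def using that insert.prems(1)
    by (intro sum_nonneg mult_nonneg_nonneg zero_le_power P0) auto
  have R_in: "R i = (\<Sum>a\<in>A. w a * G i a)" if "i \<in> J" for i
  proof -
    have *: "insert u S \<inter> N i = insert u (S \<inter> N i)" "u \<in> N i" using that by (auto simp: J_def)
    show ?thesis
      unfolding R_def * G_def F'_def using insert.hyps assms(3) *(2)
      by (simp add: sum_PiE_insert P_ins sum_distrib_left mult.assoc)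
  qed
  \<comment> \<open>Outside \<open>J\<close> the slice does not depend on \<open>a\<close>, so these
    factors can later leave the sum over \<open>a\<close>. This leaves \<open>card J = k\<close>
    factors, as many as the exponent in Hoelder's inequality.\<close>
  have R_out: "R i = G i a" if "i \<in> I - J" for i a
  proof -
    have *: "insert u S \<inter> N i = S \<inter> N i" "u \<notin> N i" using that by (auto simp: J_def)
    show ?thesis unfolding R_def G_def F'_def * using *(2) by simp
  qed
  have "(\<Sum>x\<in>insert u S \<rightarrow>\<^sub>E A. P (insert u S) x * (\<Prod>i\<in>I. F i (restrict x (N i))))
      = (\<Sum>a\<in>A. w a * (\<Sum>x\<in>S \<rightarrow>\<^sub>E A. P S x * (\<Prod>i\<in>I. F' a i (restrict x (N i)))))"
  proof -
    have "F i (restrict (x(u := a)) (N i)) = F' a i (restrict x (N i))" for i x a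
      by (auto simp: F'_def intro!: arg_cong[of _ _ "F i"])
    then show ?thesis
      using insert.hyps assms(3)
      by (simp add: sum_PiE_insert P_ins sum_distrib_left mult.assoc)
  qed
  \<comment> \<open>For fixed \<open>a\<close> use the induction hypothesis; then sum over \<open>a\<close> by Hoelder, applied only to
    the \<open>k\<close> factors that depend on the coordinate \<open>u\<close>.\<close>
  also have "\<dots> \<le> (\<Sum>a\<in>A. w a * (\<Prod>i\<in>I. root k (G i a)))"
  proof (intro sum_mono mult_left_mono w)
    fix a
    show "(\<Sum>x\<in>S \<rightarrow>\<^sub>E A. P S x * (\<Prod>i\<in>I. F' a i (restrict x (N i)))) \<le> (\<Prod>i\<in>I. root k (G i a))"
      unfolding G_def P_def using insert.prems
      by (intro insert.IH) (auto simp: F'_def)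
  qed
  also have "\<dots> = (\<Sum>a\<in>A. w a * (\<Prod>i\<in>J. root k (G i a))) * (\<Prod>i\<in>I - J. root k (R i))"
  proof -
    have "(\<Prod>i\<in>I. root k (G i a)) = (\<Prod>i\<in>J. root k (G i a)) * (\<Prod>i\<in>I - J. root k (R i))" for a
    proof -
      have "(\<Prod>i\<in>I - J. root k (R i)) = (\<Prod>i\<in>I - J. root k (G i a))"
        by (rule prod.cong) (simp_all add: R_out[of _ a])
      then show ?thesis
        using prod.subset_diff[OF J(3) assms(2), of "\<lambda>i. root k (G i a)"] by (simp add: mult.commute)
    qed
    then show ?thesis by (simp add: sum_distrib_right mult.assoc)
  qed
  also have "\<dots> \<le> (\<Prod>i\<in>J. root k (\<Sum>a\<in>A. w a * root k (G i a) ^ k)) * (\<Prod>i\<in>I - J. root k (R i))"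
  proof (intro mult_right_mono sum_prod_le_prod_root prod_nonneg)
    fix i assume i: "i \<in> I - J"
    then show "0 \<le> root k (R i)" using R_out[OF i] G0[of i] by (metis DiffD1 real_root_ge_zero)
  qed (use J assms w G0 in auto)
  also have "(\<Prod>i\<in>J. root k (\<Sum>a\<in>A. w a * root k (G i a) ^ k)) = (\<Prod>i\<in>J. root k (R i))"
    using G0 J(3) assms(4)
    by (intro prod.cong refl) (auto simp: R_in subset_iff)
  also have "(\<Prod>i\<in>J. root k (R i)) * (\<Prod>i\<in>I - J. root k (R i)) = (\<Prod>i\<in>I. root k (R i))"
    using prod.subset_diff[OF J(3) assms(2), of "\<lambda>i. root k (R i)"] by (simp add: mult.commute)
  finally show ?case unfolding R_def P_def .
qed

section \<open>Partition functions of maps into the tilde graph\<close>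

definition closed_nbhd :: "'v pair_pre_digraph \<Rightarrow> 'v \<Rightarrow> 'v set" where
  "closed_nbhd G v = insert v {u. (v, u) \<in> parcs G}"

text \<open>With \<open>N\<close> the closed neighbourhood of a vertex \<open>v\<close>, this is the
  factor left by \<open>v\<close> when its \<open>B\<close>-coordinate is summed out for fixed
  \<open>x\<close>.\<close>

definition common_nbr_weight ::
    "('a \<times> 'a) set \<Rightarrow> 'a set \<Rightarrow> ('a \<Rightarrow> real) \<Rightarrow> 'v set \<Rightarrow> ('v \<Rightarrow> 'a) \<Rightarrow> real" where
  "common_nbr_weight E B \<nu> N x = (\<Sum>b\<in>B. \<nu> b * of_bool (\<forall>u\<in>N. (x u, b) \<in> E))"

lemma prod_of_bool:
  "finite S \<Longrightarrow> (\<Prod>i\<in>S. of_bool (Q i) :: real) = of_bool (\<forall>i\<in>S. Q i)"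
  by (induction S rule: finite_induct) auto

text \<open>The neighbourhoods are closed because the case \<open>u = v\<close> of the edge
  condition says that the pair \<open>(x v, y v)\<close> is a vertex of the tilde graph. Once
  \<open>x\<close> is fixed, the values \<open>y v\<close> are constrained independently, so the sum
  over \<open>y\<close> factors over \<open>v\<close>.\<close>

lemma partition_function_tilde:
  fixes G :: "'v pair_pre_digraph" and E :: "('a \<times> 'a) set"
  assumes fin: "finite (pverts G)" "finite A" "finite B"
    and arcs: "parcs G \<subseteq> pverts G \<times> pverts G" and "sym (parcs G)"
    and E: "E \<subseteq> A \<times> B"
  shows "partition_function G (tilde_graph E) (tilde_weight \<nu>) =
    (\<Sum>x\<in>pverts G \<rightarrow>\<^sub>E A. (\<Prod>v\<in>pverts G. \<nu> (x v)) *
       (\<Prod>v\<in>pverts G. common_nbr_weight E B \<nu> (closed_nbhd G v) x))"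
proof -
  define V where "V = pverts G"
  define Q where "Q x y \<longleftrightarrow> (\<forall>v\<in>V. \<forall>u\<in>closed_nbhd G v. (x u, y v) \<in> E)" for x y :: "'v \<Rightarrow> 'a"
  define T where "T = (\<lambda>(x, y). (\<Prod>v\<in>V. \<nu> (x v)) * (\<Prod>v\<in>V. \<nu> (y v)) * of_bool (Q x y))"
  define p where "p \<phi> = (restrict (\<lambda>v. fst (\<phi> v)) V, restrict (\<lambda>v. snd (\<phi> v)) V)"
    for \<phi> :: "'v \<Rightarrow> 'a \<times> 'a"
  define q where "q = (\<lambda>(x, y). restrict (\<lambda>v. (x v, y v)) V :: 'v \<Rightarrow> 'a \<times> 'a)"
  have V: "finite V" using fin by (simp add: V_def)
  have fA: "finite (parcs G)" using arcs V by (meson V_def finite_SigmaI finite_subset fin(1))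
  have term_eq: "(\<Prod>(u, v)\<in>parcs G. indicator (parcs (tilde_graph E)) (\<phi> u, \<phi> v)) *
        (\<Prod>w\<in>V. tilde_weight \<nu> (\<phi> w)) = T (p \<phi>)" if \<phi>: "\<phi> \<in> V \<rightarrow>\<^sub>E E" for \<phi>
  proof -
    have mem: "(fst (\<phi> v), snd (\<phi> v)) \<in> E" if "v \<in> V" for v using \<phi> that by auto
    have "(\<Prod>(u, v)\<in>parcs G. indicator (parcs (tilde_graph E)) (\<phi> u, \<phi> v) :: real)
        = of_bool (\<forall>(u, v)\<in>parcs G. (\<phi> u, \<phi> v) \<in> parcs (tilde_graph E))"
      by (subst prod_of_bool[OF fA, symmetric])
        (auto intro!: prod.cong simp: indicator_def)
    also have "(\<forall>(u, v)\<in>parcs G. (\<phi> u, \<phi> v) \<in> parcs (tilde_graph E)) \<longleftrightarrow> Q (fst (p \<phi>)) (snd (p \<phi>))"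
    proof -
      \<comment> \<open>An arc imposes two edge conditions; by symmetry of \<open>G\<close>, the
        second is the first for the reversed arc.\<close>
      have "(\<phi> u, \<phi> v) \<in> parcs (tilde_graph E) \<longleftrightarrow>
          (fst (\<phi> u), snd (\<phi> v)) \<in> E \<and> (fst (\<phi> v), snd (\<phi> u)) \<in> E" if "(u, v) \<in> parcs G" for u v
        using mem[of u] mem[of v] that arcs
        by (cases "\<phi> u"; cases "\<phi> v") (auto simp: tilde_graph_def V_def)
      moreover have "(v, u) \<in> parcs G" if "(u, v) \<in> parcs G" for u v
        using that assms(5) by (meson symD)
      moreover have "u \<in> V \<and> v \<in> V" if "(u, v) \<in> parcs G" for u v
        using that arcs by (auto simp: V_def)
      ultimately show ?thesis
        using mem unfolding Q_def closed_nbhd_def p_def by (auto split: prod.splits)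
    qed
    finally have 1: "(\<Prod>(u, v)\<in>parcs G. indicator (parcs (tilde_graph E)) (\<phi> u, \<phi> v) :: real)
        = of_bool (Q (fst (p \<phi>)) (snd (p \<phi>)))" .
    have 2: "(\<Prod>w\<in>V. tilde_weight \<nu> (\<phi> w)) =
        (\<Prod>v\<in>V. \<nu> (fst (p \<phi>) v)) * (\<Prod>v\<in>V. \<nu> (snd (p \<phi>) v))"
      by (simp add: tilde_weight_def case_prod_unfold prod.distrib p_def)
    show ?thesis unfolding 1 2 by (simp add: T_def case_prod_unfold)
  qed
  have "partition_function G (tilde_graph E) (tilde_weight \<nu>)
      = (\<Sum>\<phi>\<in>V \<rightarrow>\<^sub>E E. T (p \<phi>))"
  proof -
    have "pverts (tilde_graph E) = E" by (simp add: tilde_graph_def)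
    then show ?thesis
      unfolding partition_function_def V_def[symmetric] by (intro sum.cong) (simp_all only: term_eq)
  qed
  also have "\<dots> = (\<Sum>z\<in>p ` (V \<rightarrow>\<^sub>E E). T z)"
  proof (subst sum.reindex)
    show "inj_on p (V \<rightarrow>\<^sub>E E)"
    proof (rule inj_on_inverseI)
      fix \<phi> assume "\<phi> \<in> V \<rightarrow>\<^sub>E E"
      then show "q (p \<phi>) = \<phi>" by (auto simp: q_def p_def fun_eq_iff)
    qed
  qed simp
  \<comment> \<open>Pairs that do not come from a map into \<open>E\<close> add nothing: they
    violate \<open>Q\<close> at some \<open>u = v\<close>. Dropping this constraint makes the ranges
    of \<open>x\<close> and \<open>y\<close> independent.\<close>
  also have "\<dots> = (\<Sum>z\<in>(V \<rightarrow>\<^sub>E A) \<times> (V \<rightarrow>\<^sub>E B). T z)"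
  proof (rule sum.mono_neutral_left)
    show "finite ((V \<rightarrow>\<^sub>E A) \<times> (V \<rightarrow>\<^sub>E B))"
      using fin V by (intro finite_cartesian_product finite_PiE) auto
    have "fst (\<phi> v) \<in> A \<and> snd (\<phi> v) \<in> B" if "\<phi> \<in> V \<rightarrow>\<^sub>E E" "v \<in> V" for \<phi> v
      using PiE_mem[OF that] E by auto
    then show "p ` (V \<rightarrow>\<^sub>E E) \<subseteq> (V \<rightarrow>\<^sub>E A) \<times> (V \<rightarrow>\<^sub>E B)"
      by (auto simp: p_def)
    show "\<forall>z\<in>(V \<rightarrow>\<^sub>E A) \<times> (V \<rightarrow>\<^sub>E B) - p ` (V \<rightarrow>\<^sub>E E). T z = 0"
    proof
      fix z assume z: "z \<in> (V \<rightarrow>\<^sub>E A) \<times> (V \<rightarrow>\<^sub>E B) - p ` (V \<rightarrow>\<^sub>E E)"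
      obtain x y where xy: "z = (x, y)" by fastforce
      have "\<not> Q x y"
      proof
        assume "Q x y"
        then have "q z \<in> V \<rightarrow>\<^sub>E E" by (auto simp: Q_def closed_nbhd_def q_def xy)
        moreover have "p (q z) = z" using z by (auto simp: p_def q_def xy fun_eq_iff)
        ultimately show False using z by (metis DiffD2 imageI)
      qed
      then show "T z = 0" by (simp add: T_def xy)
    qed
  qed
  also have "\<dots> = (\<Sum>x\<in>V \<rightarrow>\<^sub>E A. \<Sum>y\<in>V \<rightarrow>\<^sub>E B. T (x, y))"
    by (simp add: sum.cartesian_product)
  also have "\<dots> = (\<Sum>x\<in>V \<rightarrow>\<^sub>E A. (\<Prod>v\<in>V. \<nu> (x v)) *
       (\<Prod>v\<in>V. common_nbr_weight E B \<nu> (closed_nbhd G v) x))"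
  proof (rule sum.cong[OF refl])
    fix x
    \<comment> \<open>Expanding the product of sums over \<open>b\<close> amounts to choosing a
      value \<open>y v\<close> for every \<open>v\<close>.\<close>
    have "(\<Prod>v\<in>V. common_nbr_weight E B \<nu> (closed_nbhd G v) x)
        = (\<Sum>y\<in>V \<rightarrow>\<^sub>E B. \<Prod>v\<in>V. \<nu> (y v) * of_bool (\<forall>u\<in>closed_nbhd G v. (x u, y v) \<in> E))"
      unfolding common_nbr_weight_def using fin V by (subst prod_sum_PiE) auto
    also have "\<dots> = (\<Sum>y\<in>V \<rightarrow>\<^sub>E B. (\<Prod>v\<in>V. \<nu> (y v)) * of_bool (Q x y))"
      by (simp only: prod.distrib prod_of_bool[OF V] Q_def)
    finally show "(\<Sum>y\<in>V \<rightarrow>\<^sub>E B. T (x, y)) = (\<Prod>v\<in>V. \<nu> (x v)) *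
        (\<Prod>v\<in>V. common_nbr_weight E B \<nu> (closed_nbhd G v) x)"
      by (simp only: T_def case_prod_conv sum_distrib_left mult.assoc)
  qed
  finally show ?thesis unfolding V_def .
qed

text \<open>All \<open>k\<close> closed neighbourhoods equal the whole vertex set, so the product
  becomes a \<open>k\<close>-th power. A bijection then relabels the vertices by an arbitrary
  \<open>k\<close>-element set \<open>N\<close>, to match the norms in Finner's inequality.\<close>

lemma partition_function_complete_tilde:
  fixes N :: "'v set" and E :: "('a \<times> 'a) set"
  assumes fin: "finite A" "finite B" and E: "E \<subseteq> A \<times> B"
    and N: "finite N" "card N = k"
  shows "partition_function (complete_graph k) (tilde_graph E) (tilde_weight \<nu>) =
    (\<Sum>x\<in>N \<rightarrow>\<^sub>E A. (\<Prod>u\<in>N. \<nu> (x u)) * common_nbr_weight E B \<nu> N x ^ k)"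
proof -
  define K where "K = {..<k}"
  obtain f where f: "bij_betw f K N"
    using N ex_bij_betw_nat_finite[of N] by (auto simp: K_def atLeast0LessThan)
  have nb: "closed_nbhd (complete_graph k) v = K" if "v \<in> K" for v
    using that by (auto simp: closed_nbhd_def complete_graph_def K_def)
  have KV: "pverts (complete_graph k) = K" by (simp add: complete_graph_def K_def)
  have "partition_function (complete_graph k) (tilde_graph E) (tilde_weight \<nu>) =
    (\<Sum>x\<in>K \<rightarrow>\<^sub>E A. (\<Prod>v\<in>K. \<nu> (x v)) *
       (\<Prod>v\<in>K. common_nbr_weight E B \<nu> (closed_nbhd (complete_graph k) v) x))"
    by (subst partition_function_tilde[OF _ fin _ _ E])
      (auto simp: complete_graph_def K_def sym_def)
  also have "\<dots> = (\<Sum>x\<in>K \<rightarrow>\<^sub>E A. (\<Prod>v\<in>K. \<nu> (x v)) * common_nbr_weight E B \<nu> K x ^ k)"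
    by (simp add: nb) (simp add: K_def)
  also have "\<dots> = (\<Sum>x\<in>N \<rightarrow>\<^sub>E A. (\<Prod>u\<in>N. \<nu> (x u)) * common_nbr_weight E B \<nu> N x ^ k)"
  proof (rule sum.reindex_bij_witness[of _ "\<lambda>x. restrict (x \<circ> f) K"
        "\<lambda>x. restrict (x \<circ> the_inv_into K f) N"])
    note inv = bij_betw_the_inv_into[OF f] f_the_inv_into_f_bij_betw[OF f]
      the_inv_into_f_f[OF bij_betw_imp_inj_on[OF f]] bij_betwE[OF f]
      bij_betwE[OF bij_betw_the_inv_into[OF f]]
    {
      fix x :: "nat \<Rightarrow> 'a" assume x: "x \<in> K \<rightarrow>\<^sub>E A"
      show "restrict (restrict (x \<circ> the_inv_into K f) N \<circ> f) K = x"
        using x inv by (auto simp: fun_eq_iff)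
      show "restrict (x \<circ> the_inv_into K f) N \<in> N \<rightarrow>\<^sub>E A"
        using x inv by auto
      define y where "y = restrict (x \<circ> the_inv_into K f) N"
      have y: "y (f v) = x v" if "v \<in> K" for v
        using that inv by (simp add: y_def)
      have "(\<Prod>u\<in>N. \<nu> (y u)) = (\<Prod>v\<in>K. \<nu> (x v))"
        by (subst prod.reindex_bij_betw[OF f, symmetric]) (simp add: y)
      moreover have "common_nbr_weight E B \<nu> N y = common_nbr_weight E B \<nu> K x"
        unfolding common_nbr_weight_def bij_betw_imp_surj_on[OF f, symmetric]
        by (simp add: y)
      ultimately show "(\<Prod>u\<in>N. \<nu> (restrict (x \<circ> the_inv_into K f) N u)) *
          common_nbr_weight E B \<nu> N (restrict (x \<circ> the_inv_into K f) N) ^ k =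
          (\<Prod>v\<in>K. \<nu> (x v)) * common_nbr_weight E B \<nu> K x ^ k"
        by (simp add: y_def)
    }
    fix x :: "'v \<Rightarrow> 'a" assume x: "x \<in> N \<rightarrow>\<^sub>E A"
    show "restrict (restrict (x \<circ> f) K \<circ> the_inv_into K f) N = x"
      using x inv by (auto simp: fun_eq_iff)
    show "restrict (x \<circ> f) K \<in> K \<rightarrow>\<^sub>E A"
      using x inv by auto
  qed
  finally show ?thesis .
qed

section \<open>Finner's inequality for the closed neighbourhoods of a regular graph\<close>

theorem theorem4:
  fixes A B :: "'a set" and E :: "('a \<times> 'a) set" and \<nu> :: "'a \<Rightarrow> real"
    and G :: "'v pair_pre_digraph" and d n :: nat
  assumes "finite A" and "finite B" and "A \<inter> B = {}"
    and "E \<subseteq> A \<times> B"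
    and "\<And>x. x \<in> A \<union> B \<Longrightarrow> \<nu> x \<ge> 0"
    and "d \<ge> 1"
    and "pair_graph G" and "regular_graph d G"
    and "card (pverts G) = n" and "n \<ge> 1"
  shows "partition_function G (tilde_graph E) (tilde_weight \<nu>)
    \<le> partition_function (complete_graph (d + 1)) (tilde_graph E) (tilde_weight \<nu>)
        powr (real n / real (d + 1))"
proof -
  interpret pair_graph G by fact
  define V where "V = pverts G"
  define N where "N = closed_nbhd G"
  define k where "k = d + 1"
  define F where "F v = common_nbr_weight E B \<nu> (N v)" for v
  define Z where "Z = partition_function (complete_graph k) (tilde_graph E) (tilde_weight \<nu>)"
  have arcs: "parcs G \<subseteq> V \<times> V" using in_arcsD1 in_arcsD2 by (auto simp: V_def)
  have sym: "sym (parcs G)" using sym_arcs by (simp add: symmetric_def)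
  have V: "finite V" by (simp add: V_def)
  have NV: "N v \<subseteq> V" if "v \<in> V" for v
    using that arcs by (auto simp: N_def closed_nbhd_def)
  have cardN: "card (N v) = k" if "v \<in> V" for v
  proof -
    have "card {u. (v, u) \<in> parcs G} = card (out_arcs (with_proj G) v)"
      by (rule bij_betw_same_card[of "\<lambda>u. (v, u)"])
        (auto simp: bij_betw_def inj_on_def out_arcs_def)
    also have "\<dots> = d"
      using assms(8) that by (simp add: regular_graph_def out_degree_def V_def)
    finally have "card {u. (v, u) \<in> parcs G} = d" .
    moreover have "finite {u. (v, u) \<in> parcs G}"
      using arcs V by (auto intro: finite_subset[of _ V])
    \<comment> \<open>Without a loop, \<open>v\<close> is not among its \<open>d\<close>
      out-neighbours and adds one to the count.\<close>
    moreover have "(v, v) \<notin> parcs G" using no_loops[of "(v, v)"] by auto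
    ultimately show ?thesis by (simp add: N_def closed_nbhd_def k_def)
  qed
  have mult: "card {v\<in>V. u \<in> N v} = k" if "u \<in> V" for u
  proof -
    \<comment> \<open>Adjacency is symmetric, so the multiplicity of \<open>u\<close> is the size of
      its own closed neighbourhood.\<close>
    have "{v\<in>V. u \<in> N v} = N u"
      using that arcs sym by (auto simp: N_def closed_nbhd_def dest: symD)
    then show ?thesis using cardN[OF that] by simp
  qed
  have F0: "F v x \<ge> 0" for v x
    unfolding F_def common_nbr_weight_def using assms(5) by (intro sum_nonneg) auto
  have F_restrict: "F v (restrict x (N v)) = F v x" for v x
    by (simp add: F_def common_nbr_weight_def)
  \<comment> \<open>The norm depends on \<open>v\<close> only through the size of
    \<open>N v\<close>, so all \<open>n\<close> factors in the bound coincide.\<close>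
  have block: "(\<Sum>x\<in>V \<inter> N v \<rightarrow>\<^sub>E A. (\<Prod>u\<in>V \<inter> N v. \<nu> (x u)) * F v x ^ k) = Z" if "v \<in> V" for v
  proof -
    have "V \<inter> N v = N v" using NV[OF that] by auto
    moreover have "finite (N v)" using NV[OF that] V by (rule finite_subset)
    ultimately show ?thesis
      unfolding Z_def F_def
      by (simp add: partition_function_complete_tilde[OF assms(1,2,4) _ cardN[OF that]])
  qed
  have "V \<noteq> {}" using assms(9,10) by (auto simp: V_def)
  then obtain v where v: "v \<in> V" by blast
  \<comment> \<open>The sign of \<open>Z\<close> is read off from the norm at any one vertex, which
    exists as \<open>n \<ge> 1\<close>.\<close>
  have Z0: "Z \<ge> 0"
    unfolding block[OF v, symmetric] using F0 assms(5)
    by (intro sum_nonneg mult_nonneg_nonneg prod_nonneg) auto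
  have "partition_function G (tilde_graph E) (tilde_weight \<nu>)
      = (\<Sum>x\<in>V \<rightarrow>\<^sub>E A. (\<Prod>v\<in>V. \<nu> (x v)) * (\<Prod>v\<in>V. F v (restrict x (N v))))"
    unfolding F_restrict unfolding V_def F_def N_def
    by (rule partition_function_tilde) (use assms arcs sym in \<open>auto simp: V_def\<close>)
  also have "\<dots> \<le> (\<Prod>v\<in>V. root k
      (\<Sum>x\<in>V \<inter> N v \<rightarrow>\<^sub>E A. (\<Prod>u\<in>V \<inter> N v. \<nu> (x u)) * F v x ^ k))"
    using assms V F0 mult by (intro Finner_inequality) (auto simp: k_def)
  also have "\<dots> = root k Z ^ n"
    using block assms(9) by (simp add: V_def)
  also have "\<dots> = Z powr (real n / real k)"
  \<comment> \<open>Passing from powers to \<open>powr\<close> requires a positive base. At 0 both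
    sides vanish, the left one because \<open>n \<ge> 1\<close>.\<close>
  proof (cases "Z = 0")
    case True
    then show ?thesis using assms(10) by (simp add: k_def)
  next
    case False
    then show ?thesis using Z0
      by (simp add: root_powr_inverse powr_powr k_def flip: powr_realpow)
  qed
  finally show ?thesis unfolding Z_def k_def .
qed

end
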